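(* Let $(X,\|\cdot\|_X)$, $(Y,\|\cdot\|_Y)$, $(Z,\|\cdot\|_Z)$ be Hilbert spaces and suppose $\mathcal{G}_n=\mathcal{O}_n\circ G$ with $G:(X,\|\cdot\|_X)\to(Y,\|\cdot\|_Y)$ and $\mathcal{O}_n:(Y,\|\cdot\|_Y)\to(Z,\|\cdot\|_Z)$. Let $\mu_0$ be a prior on $X$, and let $\xi_n$ be Gaussian noise with law $\mathcal{L}(\xi_n)$. Assume that (i) there is an increasing function $b:\mathbb{R}^+\to\mathbb{R}^+$ with $b(0)=0$ such that $\|a_1-a_2\|_X\le b\big(\|G(a_1)-G(a_2)\|_Y\big)$ for all $a_1,a_2$; (ii) the sequence of Bayesian inverse problems $(G_\star\mu_0,\mathcal{O}_n,\mathcal{L}(\xi_n))$ is posterior consistent with respect to $\|\cdot\|_Y$ for all $p^\dagger\in A$ with rate $\epsilon_n$, where $A\subseteq Y$ and $G_\star\mu_0$ is the push-forward of $\mu_0$ under $G$. Then $(\mu_0,\mathcal{G}_n,\mathcal{L}(\xi_n))$ is posterior consistent with respect to $\|\cdot\|_X$ for all $a^\dagger\in G^{-1}(A)$ with rate $b(\epsilon_n)$.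
   Context: Bayesian inverse problem: for a prior $\mu_0$, a forward operator $\mathcal{G}_n$ and centred Gaussian noise $\xi_n\sim\mathcal{N}(0,\Gamma_n)$, the posterior given data $y$ is the probability measure $\mu^{y}$ with $$\frac{d\mu^{y}}{d\mu_0}(a)\propto\exp\Big(-\tfrac12\|\mathcal{G}_n(a)\|_{\Gamma_n}^2+\langle y,\mathcal{G}_n(a)\rangle_{\Gamma_n}\Big),\qquad \langle u,v\rangle_{\Gamma_n}=\langle \Gamma_n^{-1}u,v\rangle,$$ where $\|\cdot\|_{\Gamma_n}$ is the Cameron–Martin norm of $\mathcal{N}(0,\Gamma_n)$; it is assumed that the posteriors are well-defined. Posterior consistency: a sequence of Bayesian inverse problems $(\mu_0,\mathcal{G}_n,\mathcal{L}(\xi_n))$ is posterior consistent for $a^\dagger$ with rate $\epsilon_n\downarrow 0$ with respect to a metric $d$ if, for $y_n=\mathcal{G}_n(a^\dagger)+\xi_n$, there exist a constant $M$ and a sequence $l_n\to1$ such that $$\mathbb{P}_{\xi_n}\Big(\mu^{y_n}\big(B^d_{M\epsilon_n}(a^\dagger)\big)\ge l_n\Big)\to1,$$ where $B^d_\epsilon(a)$ is the ball of radius $\epsilon$ around $a$ with respect to $d$ and $\mu^{y_n}$ is the posterior corresponding to prior $\mu_0$, forward operator $\mathcal{G}_n$, noise law $\mathcal{L}(\xi_n)$ and data $y_n$.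
   Formalization: Rate b(ε_n) is false for general increasing b; it is proved when b(ε_n)→0 and b(Mε_n)=O(b(ε_n)) for every M>0; without these, the posterior is shown to concentrate on balls of radius b(Mε_n) for some M>0. G and O_n are taken Borel measurable. *)

theory Defs
  imports "HOL-Probability.Probability" "HOL-Library.Landau_Symbols"
begin

text \<open>
  A real Hilbert space is a type of class \<open>{real_inner, complete_space}\<close>; it carries its Borel
  sigma-algebra. The law \<open>N(0, \<Gamma>)\<close> is identified by its characteristic functional
  \<open>z \<mapsto> exp (- \<langle>\<Gamma> z, z\<rangle> / 2)\<close>, which also forces \<open>\<Gamma>\<close> to be positive semidefinite.
\<close>

definition centred_gaussian :: "'z::real_inner measure \<Rightarrow> ('z \<Rightarrow> 'z) \<Rightarrow> bool" where
  "centred_gaussian \<nu> \<Gamma> \<longleftrightarrow>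
     prob_space \<nu> \<and> sets \<nu> = sets borel \<and>
     bounded_linear \<Gamma> \<and> (\<forall>u v. \<Gamma> u \<bullet> v = u \<bullet> \<Gamma> v) \<and>
     (\<forall>z. (CLINT x|\<nu>. iexp (z \<bullet> x)) = complex_of_real (exp (- (\<Gamma> z \<bullet> z) / 2)))"

text \<open>
  Cameron--Martin norm of \<open>N(0, \<Gamma>)\<close>: the supremum of the values at \<open>h\<close> of the functionals
  \<open>\<langle>\<cdot>, z\<rangle>\<close> with variance at most 1. It is infinite off the Cameron--Martin space, and
  \<open>\<langle>\<Gamma>\<^sup>-\<^sup>1 h, h\<rangle>\<close> is its square on the range of an injective \<open>\<Gamma>\<close>.
\<close>

definition cm_norm :: "('z::real_inner \<Rightarrow> 'z) \<Rightarrow> 'z \<Rightarrow> ennreal" where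
  "cm_norm \<Gamma> h = (SUP z\<in>{z. \<Gamma> z \<bullet> z \<le> 1}. ennreal (h \<bullet> z))"

definition cm_space :: "('z::real_inner \<Rightarrow> 'z) \<Rightarrow> 'z set" where
  "cm_space \<Gamma> = {h. cm_norm \<Gamma> h < \<top>}"

text \<open>
  \<open>pairing u v\<close> stands for \<open>\<langle>u, v\<rangle>\<^sub>\<Gamma> = \<langle>\<Gamma>\<^sup>-\<^sup>1 u, v\<rangle>\<close> with \<open>v\<close> in the Cameron--Martin space and \<open>u\<close> a
  data point. In infinite dimensions \<open>u\<close> is almost surely outside the Cameron--Martin space, so
  this is the usual measurable extension: for \<open>v = \<Gamma> z\<close> it is \<open>\<langle>u, z\<rangle>\<close>, and for other \<open>v\<close> the
  \<open>L\<^sup>2(N(0, \<Gamma>))\<close>-limit of \<open>\<langle>u, z\<^sub>k\<rangle>\<close> along \<open>\<Gamma> z\<^sub>k \<rightarrow> v\<close> in Cameron--Martin norm. This fixes \<open>pairing\<close> only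
  up to a null set of \<open>u\<close> for each \<open>v\<close>; the predicate describes its jointly measurable versions,
  which all lead to the same posterior for almost every \<open>u\<close>.
\<close>

definition cm_pairing :: "'z::real_inner measure \<Rightarrow> ('z \<Rightarrow> 'z) \<Rightarrow> ('z \<Rightarrow> 'z \<Rightarrow> real) \<Rightarrow> bool" where
  "cm_pairing \<nu> \<Gamma> pairing \<longleftrightarrow>
     (\<lambda>(u, v). pairing u v) \<in> borel_measurable (borel \<Otimes>\<^sub>M borel) \<and>
     (\<forall>v\<in>cm_space \<Gamma>. \<exists>z :: nat \<Rightarrow> 'z.
        (\<lambda>k. cm_norm \<Gamma> (\<Gamma> (z k) - v)) \<longlonglongrightarrow> 0 \<and>
        (\<lambda>k. \<integral>\<^sup>+u. ennreal ((u \<bullet> z k - pairing u v)\<^sup>2) \<partial>\<nu>) \<longlonglongrightarrow> 0)"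

definition likelihood ::
    "('z::real_inner \<Rightarrow> 'z) \<Rightarrow> ('z \<Rightarrow> 'z \<Rightarrow> real) \<Rightarrow> 'z \<Rightarrow> 'z \<Rightarrow> real" where
  "likelihood \<Gamma> pairing y v = exp (- (1/2) * (enn2real (cm_norm \<Gamma> v))\<^sup>2 + pairing y v)"

definition evidence ::
    "'a measure \<Rightarrow> ('a \<Rightarrow> 'z::real_inner) \<Rightarrow> ('z \<Rightarrow> 'z) \<Rightarrow> ('z \<Rightarrow> 'z \<Rightarrow> real) \<Rightarrow> 'z \<Rightarrow> ennreal" where
  "evidence \<mu>0 \<G> \<Gamma> pairing y = (\<integral>\<^sup>+a. ennreal (likelihood \<Gamma> pairing y (\<G> a)) \<partial>\<mu>0)"

definition posterior ::
    "'a measure \<Rightarrow> ('a \<Rightarrow> 'z::real_inner) \<Rightarrow> ('z \<Rightarrow> 'z) \<Rightarrow> ('z \<Rightarrow> 'z \<Rightarrow> real) \<Rightarrow> 'z \<Rightarrow> 'a measure" where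
  "posterior \<mu>0 \<G> \<Gamma> pairing y =
     density \<mu>0 (\<lambda>a. ennreal (likelihood \<Gamma> pairing y (\<G> a)) / evidence \<mu>0 \<G> \<Gamma> pairing y)"

text \<open>
  Well-definedness of the posterior for the data \<open>y = \<G> a\<^sub>0 + \<xi>\<close>. The evidence is positive
  automatically, so finiteness makes the posterior a probability measure; where it is infinite,
  \<open>posterior\<close> is the zero measure.
\<close>

definition posterior_well_defined ::
    "'a measure \<Rightarrow> ('a \<Rightarrow> 'z::real_inner) \<Rightarrow> ('z \<Rightarrow> 'z) \<Rightarrow> ('z \<Rightarrow> 'z \<Rightarrow> real) \<Rightarrow> 'z measure \<Rightarrow> 'a \<Rightarrow> bool"
  where
  "posterior_well_defined \<mu>0 \<G> \<Gamma> pairing \<nu> a\<^sub>0 \<longleftrightarrow>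
     (AE a in \<mu>0. \<G> a \<in> cm_space \<Gamma>) \<and> \<G> a\<^sub>0 \<in> cm_space \<Gamma> \<and>
     (AE \<xi> in \<nu>. evidence \<mu>0 \<G> \<Gamma> pairing (\<G> a\<^sub>0 + \<xi>) < \<top>)"

text \<open>
  \<open>\<nu> n\<close> is the law of the noise \<open>\<xi>\<^sub>n\<close> and \<open>a\<^sub>0\<close> the true parameter. Balls are closed: for positive
  radii this makes no difference to consistency, because of the constant \<open>M\<close>.
\<close>

definition posterior_concentrates ::
    "'a::metric_space measure \<Rightarrow> (nat \<Rightarrow> 'a \<Rightarrow> 'z::real_inner) \<Rightarrow> (nat \<Rightarrow> 'z \<Rightarrow> 'z) \<Rightarrow>
     (nat \<Rightarrow> 'z \<Rightarrow> 'z \<Rightarrow> real) \<Rightarrow> (nat \<Rightarrow> 'z measure) \<Rightarrow> 'a \<Rightarrow> (nat \<Rightarrow> real) \<Rightarrow> bool" where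
  "posterior_concentrates \<mu>0 \<G> \<Gamma> pairing \<nu> a\<^sub>0 r \<longleftrightarrow>
     (\<exists>l :: nat \<Rightarrow> real. l \<longlonglongrightarrow> 1 \<and>
        (\<lambda>n. measure (\<nu> n) {\<xi> \<in> space (\<nu> n).
            measure (posterior \<mu>0 (\<G> n) (\<Gamma> n) (pairing n) (\<G> n a\<^sub>0 + \<xi>)) (cball a\<^sub>0 (r n)) \<ge> l n})
          \<longlonglongrightarrow> 1)"

definition posterior_consistent ::
    "'a::metric_space measure \<Rightarrow> (nat \<Rightarrow> 'a \<Rightarrow> 'z::real_inner) \<Rightarrow> (nat \<Rightarrow> 'z \<Rightarrow> 'z) \<Rightarrow>
     (nat \<Rightarrow> 'z \<Rightarrow> 'z \<Rightarrow> real) \<Rightarrow> (nat \<Rightarrow> 'z measure) \<Rightarrow> 'a \<Rightarrow> (nat \<Rightarrow> real) \<Rightarrow> bool" where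
  "posterior_consistent \<mu>0 \<G> \<Gamma> pairing \<nu> a\<^sub>0 \<epsilon> \<longleftrightarrow>
     decseq \<epsilon> \<and> \<epsilon> \<longlonglongrightarrow> 0 \<and>
     (\<exists>M. posterior_concentrates \<mu>0 \<G> \<Gamma> pairing \<nu> a\<^sub>0 (\<lambda>n. M * \<epsilon> n))"

end

theory Submission imports Defs begin

text \<open>
  The posterior for the pushed-forward prior is the push-forward of the posterior, and the
  stability estimate says that the preimage under \<open>G\<close> of the \<open>Y\<close>-ball of radius \<open>\<rho>\<close> around \<open>G a\<close>
  lies in the \<open>X\<close>-ball of radius \<open>b \<rho>\<close> around \<open>a\<close>. So the posterior on \<open>X\<close> puts at least as much
  mass on the latter as the posterior on \<open>Y\<close> puts on the former. The remaining point is that the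
  events in the definition of consistency are measurable, without which \<open>measure\<close> returns 0.
\<close>

text \<open>As a supremum of continuous functions, \<open>cm_norm \<Gamma>\<close> is lower
  semicontinuous. Its superlevel sets are unions of open sets, so the uncountable index set does no
  harm.\<close>

lemma cm_norm_measurable [measurable]: "cm_norm \<Gamma> \<in> borel_measurable borel"
proof (rule borel_measurableI_greater)
  fix y :: ennreal
  have "{h. y < cm_norm \<Gamma> h} = (\<Union>z\<in>{z. \<Gamma> z \<bullet> z \<le> 1}. {h. y < ennreal (h \<bullet> z)})"
    by (auto simp: cm_norm_def less_SUP_iff)
  also have "open \<dots>"
    by (intro open_UN ballI open_Collect_less continuous_on_ennreal continuous_intros)
  finally show "{h \<in> space borel. y < cm_norm \<Gamma> h} \<in> sets borel"
    by simp
qed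

lemma likelihood_measurable [measurable]:
  assumes pairing: "(\<lambda>(u, v). pairing u v) \<in> borel_measurable (borel \<Otimes>\<^sub>M borel)"
    and [measurable]: "f \<in> borel_measurable M" "g \<in> borel_measurable M"
  shows "(\<lambda>x. likelihood \<Gamma> pairing (f x) (g x)) \<in> borel_measurable M"
proof -
  have [measurable]: "(\<lambda>x. pairing (f x) (g x)) \<in> borel_measurable M"
    using measurable_compose[OF measurable_Pair[OF assms(2,3)] pairing] by simp
  show ?thesis
    unfolding likelihood_def by measurable
qed

text \<open>The density at \<open>a\<close> depends on \<open>a\<close> only through
  \<open>G a\<close>. Change of variables therefore gives both problems the same normalising
  constant, and the density can be pulled through the push-forward.\<close>

lemma posterior_distr:
  assumes pairing: "(\<lambda>(u, v). pairing u v) \<in> borel_measurable (borel \<Otimes>\<^sub>M borel)"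
    and [measurable]: "G \<in> borel_measurable \<mu>" "Ob \<in> borel_measurable borel"
  shows "posterior (distr \<mu> borel G) Ob \<Gamma> pairing y =
    distr (posterior \<mu> (Ob \<circ> G) \<Gamma> pairing y) borel G"
proof -
  note [measurable] = likelihood_measurable[OF pairing]
  have "evidence (distr \<mu> borel G) Ob \<Gamma> pairing y = evidence \<mu> (Ob \<circ> G) \<Gamma> pairing y"
    unfolding evidence_def by (subst nn_integral_distr) auto
  then show ?thesis
    unfolding posterior_def by (subst density_distr) auto
qed

text \<open>The total mass is the evidence divided by itself: 1 if the evidence is finite, 0 if it
  is infinite. Finiteness for every \<open>y\<close> is what makes \<open>measure\<close> monotone
  under inclusion of balls.\<close>

lemma finite_measure_posterior:
  assumes pairing: "(\<lambda>(u, v). pairing u v) \<in> borel_measurable (borel \<Otimes>\<^sub>M borel)"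
    and "prob_space \<mu>" and [measurable]: "\<G> \<in> borel_measurable \<mu>"
  shows "finite_measure (posterior \<mu> \<G> \<Gamma> pairing y)"
proof
  interpret prob_space \<mu> by fact
  note [measurable] = likelihood_measurable[OF pairing]
  let ?L = "\<lambda>a. ennreal (likelihood \<Gamma> pairing y (\<G> a))"
  have "evidence \<mu> \<G> \<Gamma> pairing y \<noteq> 0"
  proof
    assume "evidence \<mu> \<G> \<Gamma> pairing y = 0"
    then have "AE a in \<mu>. ?L a = 0"
      unfolding evidence_def by (subst (asm) nn_integral_0_iff_AE) auto
    \<comment> \<open>The likelihood is an exponential, hence positive; vanishing almost everywhere
      would make the whole space a null set of a probability measure.\<close>
    then show False
      by (simp add: likelihood_def ennreal_eq_0_iff not_le[symmetric] AE_False)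
  qed
  moreover have "emeasure (posterior \<mu> \<G> \<Gamma> pairing y) (space (posterior \<mu> \<G> \<Gamma> pairing y)) =
      evidence \<mu> \<G> \<Gamma> pairing y / evidence \<mu> \<G> \<Gamma> pairing y"
    unfolding posterior_def
    by (simp add: emeasure_density cong: nn_integral_cong)
       (simp add: nn_integral_divide evidence_def)
  ultimately show "emeasure (posterior \<mu> \<G> \<Gamma> pairing y) (space (posterior \<mu> \<G> \<Gamma> pairing y)) \<noteq> \<infinity>"
    by (auto simp: ennreal_divide_eq_top_iff)
qed

text \<open>The mass of \<open>B\<close> is a quotient of two integrals over \<open>\<mu>\<close>
  with parameter \<xi>. Joint measurability of \<open>pairing\<close> makes the integrands
  measurable on the product, so both integrals are measurable in \<xi>. The shift \<open>c\<close>
  is the noiseless observation.\<close>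

lemma measure_posterior_measurable:
  fixes \<G> :: "'a \<Rightarrow> 'z::real_inner"
  assumes pairing: "(\<lambda>(u, v). pairing u v) \<in> borel_measurable (borel \<Otimes>\<^sub>M borel)"
    and "prob_space \<mu>" and [measurable]: "\<G> \<in> borel_measurable \<mu>"
    and [measurable]: "B \<in> sets \<mu>"
  shows "(\<lambda>\<xi>. measure (posterior \<mu> \<G> \<Gamma> pairing (c + \<xi>)) B) \<in> borel_measurable borel"
proof -
  interpret prob_space \<mu> by fact
  note [measurable] = likelihood_measurable[OF pairing]
  have shift [measurable]: "(\<lambda>\<xi>. c + \<xi>) \<in> borel_measurable borel"
    by (intro borel_measurable_continuous_onI continuous_intros)
  have [measurable]: "(\<lambda>x. c + fst x) \<in> borel_measurable (borel \<Otimes>\<^sub>M \<mu>)"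
    by (rule measurable_compose[OF measurable_fst shift])
  have [measurable]: "(\<lambda>\<xi>. evidence \<mu> \<G> \<Gamma> pairing (c + \<xi>)) \<in> borel_measurable borel"
    unfolding evidence_def
    by (intro borel_measurable_nn_integral) (simp add: case_prod_beta)
  have "emeasure (posterior \<mu> \<G> \<Gamma> pairing (c + \<xi>)) B =
      (\<integral>\<^sup>+a. ennreal (likelihood \<Gamma> pairing (c + \<xi>) (\<G> a)) * indicator B a \<partial>\<mu>) /
        evidence \<mu> \<G> \<Gamma> pairing (c + \<xi>)" for \<xi>
    unfolding posterior_def
    by (subst emeasure_density)
       (auto simp: nn_integral_divide[symmetric] ennreal_times_divide mult.commute)
  moreover have "(\<lambda>\<xi>. (\<integral>\<^sup>+a. ennreal (likelihood \<Gamma> pairing (c + \<xi>) (\<G> a)) * indicator B a \<partial>\<mu>))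
      \<in> borel_measurable borel"
    by (intro borel_measurable_nn_integral) (simp add: case_prod_beta)
  ultimately show ?thesis
    unfolding measure_def by simp
qed

text \<open>The same \<open>l\<close> serves both problems, since the first event is eventually
  contained in the second. Monotonicity of \<open>measure\<close> asks for measurability of the
  larger event, which is why the regularity assumptions concern \<open>\<mu>0\<close> and
  \<open>\<G>0\<close>.\<close>

lemma posterior_concentrates_mono:
  fixes \<mu>0 :: "'a::metric_space measure" and \<mu>1 :: "'b::metric_space measure"
  assumes "posterior_concentrates \<mu>1 \<G>1 \<Gamma> pairing \<nu> a1 r1"
    and "prob_space \<mu>0" and sets: "sets \<mu>0 = sets borel"
    and meas: "\<And>n. \<G>0 n \<in> borel_measurable borel"
    and noise: "\<And>n. prob_space (\<nu> n)" "\<And>n. sets (\<nu> n) = sets borel"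
    and pairing: "\<And>n. (\<lambda>(u, v). pairing n u v) \<in> borel_measurable (borel \<Otimes>\<^sub>M borel)"
    and le: "\<forall>\<^sub>F n in sequentially. \<forall>\<xi>.
      measure (posterior \<mu>1 (\<G>1 n) (\<Gamma> n) (pairing n) (\<G>1 n a1 + \<xi>)) (cball a1 (r1 n))
      \<le> measure (posterior \<mu>0 (\<G>0 n) (\<Gamma> n) (pairing n) (\<G>0 n a0 + \<xi>)) (cball a0 (r0 n))"
  shows "posterior_concentrates \<mu>0 \<G>0 \<Gamma> pairing \<nu> a0 r0"
proof -
  obtain l where l: "l \<longlonglongrightarrow> 1" and lim:
    "(\<lambda>n. measure (\<nu> n) {\<xi> \<in> space (\<nu> n).
        measure (posterior \<mu>1 (\<G>1 n) (\<Gamma> n) (pairing n) (\<G>1 n a1 + \<xi>)) (cball a1 (r1 n)) \<ge> l n})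
      \<longlonglongrightarrow> 1"
    using assms(1) unfolding posterior_concentrates_def by blast
  let ?E = "\<lambda>n. {\<xi> \<in> space (\<nu> n).
        measure (posterior \<mu>0 (\<G>0 n) (\<Gamma> n) (pairing n) (\<G>0 n a0 + \<xi>)) (cball a0 (r0 n)) \<ge> l n}"
  have E: "?E n \<in> sets (\<nu> n)" for n
  proof -
    have "\<G>0 n \<in> borel_measurable \<mu>0" "cball a0 (r0 n) \<in> sets \<mu>0"
      using meas sets by (auto cong: measurable_cong_sets)
    note measure_posterior_measurable[OF pairing \<open>prob_space \<mu>0\<close> this]
    then have [measurable]: "(\<lambda>\<xi>. measure (posterior \<mu>0 (\<G>0 n) (\<Gamma> n) (pairing n) (\<G>0 n a0 + \<xi>))
        (cball a0 (r0 n))) \<in> borel_measurable (\<nu> n)"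
      using noise(2) by (simp cong: measurable_cong_sets)
    show ?thesis by measurable
  qed
  have "(\<lambda>n. measure (\<nu> n) (?E n)) \<longlonglongrightarrow> 1"
  proof (rule tendsto_sandwich[OF _ _ lim tendsto_const])
    show "\<forall>\<^sub>F n in sequentially. measure (\<nu> n) {\<xi> \<in> space (\<nu> n).
        measure (posterior \<mu>1 (\<G>1 n) (\<Gamma> n) (pairing n) (\<G>1 n a1 + \<xi>)) (cball a1 (r1 n)) \<ge> l n}
      \<le> measure (\<nu> n) (?E n)"
      using le
    proof eventually_elim
      case (elim n)
      interpret prob_space "\<nu> n" by (rule noise)
      show ?case
        using elim by (intro finite_measure_mono E) (auto intro: order_trans)
    qed
    show "\<forall>\<^sub>F n in sequentially. measure (\<nu> n) (?E n) \<le> 1"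
      by (simp add: prob_space.prob_le_1[OF noise(1)])
  qed
  with l show ?thesis
    unfolding posterior_concentrates_def by blast
qed

text \<open>Stability yields the radius \<open>b (M * \<epsilon> n)\<close>, with the constant
  inside \<open>b\<close>, while rate \<open>b (\<epsilon> n)\<close> allows a constant only in
  front. A monotone \<open>b\<close> may jump at 0, or behave like exp(-1/t), where no constant can
  be pulled out. Hence the second conjunct is conditional; its conditions hold for powers t^\<alpha>
  with \<alpha> > 0.\<close>

theorem theorem2p3:
  fixes \<mu>0 :: "'x::{real_inner, complete_space} measure"
    and G :: "'x \<Rightarrow> 'y::{real_inner, complete_space}"
    and Obs :: "nat \<Rightarrow> 'y \<Rightarrow> 'z::{real_inner, complete_space}"
    and \<nu> :: "nat \<Rightarrow> 'z measure"
    and \<Gamma> :: "nat \<Rightarrow> 'z \<Rightarrow> 'z"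
    and pairing :: "nat \<Rightarrow> 'z \<Rightarrow> 'z \<Rightarrow> real"
    and b :: "real \<Rightarrow> real"
    and \<epsilon> :: "nat \<Rightarrow> real"
    and A :: "'y set"
  assumes prior: "prob_space \<mu>0" "sets \<mu>0 = sets borel"
    and G_meas: "G \<in> borel_measurable borel"
    and Obs_meas: "\<And>n. Obs n \<in> borel_measurable borel"
    and noise: "\<And>n. centred_gaussian (\<nu> n) (\<Gamma> n)"
    and pairing: "\<And>n. cm_pairing (\<nu> n) (\<Gamma> n) (pairing n)"
    and well_defined: "\<And>n a. a \<in> G -` A \<Longrightarrow>
      posterior_well_defined \<mu>0 (Obs n \<circ> G) (\<Gamma> n) (pairing n) (\<nu> n) a"
    and b_increasing: "b \<in> {0..} \<rightarrow> {0..}" "mono_on {0..} b" "b 0 = 0"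
    and stability: "\<And>a1 a2. norm (a1 - a2) \<le> b (norm (G a1 - G a2))"
    and consistent: "\<And>p. p \<in> A \<Longrightarrow>
      posterior_consistent (distr \<mu>0 borel G) Obs \<Gamma> pairing \<nu> p \<epsilon>"
  shows "\<forall>a \<in> G -` A.
      (\<exists>M>0. posterior_concentrates \<mu>0 (\<lambda>n. Obs n \<circ> G) \<Gamma> pairing \<nu> a (\<lambda>n. b (M * \<epsilon> n))) \<and>
      ((\<lambda>n. b (\<epsilon> n)) \<longlonglongrightarrow> 0 \<and> (\<forall>M>0. (\<lambda>n. b (M * \<epsilon> n)) \<in> O(\<lambda>n. b (\<epsilon> n))) \<longrightarrow>
        posterior_consistent \<mu>0 (\<lambda>n. Obs n \<circ> G) \<Gamma> pairing \<nu> a (\<lambda>n. b (\<epsilon> n)))"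
proof (intro ballI)
  fix a assume a: "a \<in> G -` A"
  have pairing': "(\<lambda>(u, v). pairing n u v) \<in> borel_measurable (borel \<Otimes>\<^sub>M borel)" for n
    using pairing[of n] by (simp add: cm_pairing_def)
  have noise': "prob_space (\<nu> n)" "sets (\<nu> n) = sets borel" for n
    using noise[of n] by (auto simp: centred_gaussian_def)
  have [measurable]: "G \<in> borel_measurable \<mu>0"
    using G_meas prior(2) by (simp cong: measurable_cong_sets)
  note [measurable] = Obs_meas
  have comp_meas: "Obs n \<circ> G \<in> borel_measurable borel" for n
    using G_meas Obs_meas by (rule measurable_comp)
  obtain M where dec: "decseq \<epsilon>" and lim: "\<epsilon> \<longlonglongrightarrow> 0"
    and M: "posterior_concentrates (distr \<mu>0 borel G) Obs \<Gamma> pairing \<nu> (G a) (\<lambda>n. M * \<epsilon> n)"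
    using consistent[of "G a"] a unfolding posterior_consistent_def by auto
  have nonneg: "\<epsilon> n \<ge> 0" for n
    using decseq_ge[OF dec lim] .
  \<comment> \<open>The radius \<open>r\<close> stays free because two choices follow. Since
    \<open>M\<close> may be negative and \<open>b\<close> is monotone only on \<open>{0..}\<close>,
    \<open>max M 1\<close> replaces it; as \<epsilon> is nonnegative, this only enlarges the
    ball.\<close>
  have transfer: "posterior_concentrates \<mu>0 (\<lambda>n. Obs n \<circ> G) \<Gamma> pairing \<nu> a r"
    if r: "\<forall>\<^sub>F n in sequentially. b (max M 1 * \<epsilon> n) \<le> r n" for r
  proof (rule posterior_concentrates_mono[OF M prior comp_meas noise' pairing'])
    show "\<forall>\<^sub>F n in sequentially. \<forall>\<xi>.
      measure (posterior (distr \<mu>0 borel G) (Obs n) (\<Gamma> n) (pairing n) (Obs n (G a) + \<xi>))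
        (cball (G a) (M * \<epsilon> n))
      \<le> measure (posterior \<mu>0 (Obs n \<circ> G) (\<Gamma> n) (pairing n) ((Obs n \<circ> G) a + \<xi>)) (cball a (r n))"
      using r
    proof eventually_elim
      case (elim n)
      show ?case
      proof
        fix \<xi>
        let ?P = "posterior \<mu>0 (Obs n \<circ> G) (\<Gamma> n) (pairing n) (Obs n (G a) + \<xi>)"
        interpret finite_measure ?P
          by (rule finite_measure_posterior[OF pairing' prior(1)]) simp
        have P: "sets ?P = sets borel" "space ?P = UNIV"
          using prior(2) sets_eq_imp_space_eq[OF prior(2)] by (auto simp: posterior_def)
        \<comment> \<open>By \<open>posterior_distr\<close>, the mass on the \<open>Y\<close> side
          is the mass of this preimage under \<open>?P\<close>, so the inclusion settles the
          comparison for every \<xi>.\<close>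
        have "G -` cball (G a) (M * \<epsilon> n) \<subseteq> cball a (r n)"
        proof
          fix x assume "x \<in> G -` cball (G a) (M * \<epsilon> n)"
          then have "norm (G a - G x) \<le> M * \<epsilon> n"
            by (simp add: dist_norm)
          also have "\<dots> \<le> max M 1 * \<epsilon> n"
            using nonneg by (intro mult_right_mono) auto
          finally have "b (norm (G a - G x)) \<le> b (max M 1 * \<epsilon> n)"
            using nonneg by (intro mono_onD[OF b_increasing(2)]) auto
          with stability[of a x] elim show "x \<in> cball a (r n)"
            by (simp add: dist_norm)
        qed
        moreover have "G \<in> borel_measurable ?P"
          using G_meas P(1) by (simp cong: measurable_cong_sets)
        ultimately show
          "measure (posterior (distr \<mu>0 borel G) (Obs n) (\<Gamma> n) (pairing n) (Obs n (G a) + \<xi>))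
            (cball (G a) (M * \<epsilon> n))
          \<le> measure (posterior \<mu>0 (Obs n \<circ> G) (\<Gamma> n) (pairing n) ((Obs n \<circ> G) a + \<xi>)) (cball a (r n))"
          using P by (simp add: posterior_distr[OF pairing'] measure_distr finite_measure_mono)
      qed
    qed
  qed
  show "(\<exists>M>0. posterior_concentrates \<mu>0 (\<lambda>n. Obs n \<circ> G) \<Gamma> pairing \<nu> a (\<lambda>n. b (M * \<epsilon> n))) \<and>
      ((\<lambda>n. b (\<epsilon> n)) \<longlonglongrightarrow> 0 \<and> (\<forall>M>0. (\<lambda>n. b (M * \<epsilon> n)) \<in> O(\<lambda>n. b (\<epsilon> n))) \<longrightarrow>
        posterior_consistent \<mu>0 (\<lambda>n. Obs n \<circ> G) \<Gamma> pairing \<nu> a (\<lambda>n. b (\<epsilon> n)))"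
  proof (intro conjI impI)
    show "\<exists>M>0. posterior_concentrates \<mu>0 (\<lambda>n. Obs n \<circ> G) \<Gamma> pairing \<nu> a (\<lambda>n. b (M * \<epsilon> n))"
      by (rule exI[of _ "max M 1"]) (simp add: transfer)
  next
    assume rate: "(\<lambda>n. b (\<epsilon> n)) \<longlonglongrightarrow> 0 \<and> (\<forall>M>0. (\<lambda>n. b (M * \<epsilon> n)) \<in> O(\<lambda>n. b (\<epsilon> n)))"
    \<comment> \<open>The growth condition trades the factor inside \<open>b\<close> for a factor
      \<open>C\<close> in front, which becomes the constant in the definition of
      consistency.\<close>
    then have "(\<lambda>n. b (max M 1 * \<epsilon> n)) \<in> O(\<lambda>n. b (\<epsilon> n))"
      by simp
    then obtain C where "\<forall>\<^sub>F n in sequentially. norm (b (max M 1 * \<epsilon> n)) \<le> C * norm (b (\<epsilon> n))"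
      by (elim landau_o.bigE)
    then have "\<forall>\<^sub>F n in sequentially. b (max M 1 * \<epsilon> n) \<le> C * b (\<epsilon> n)"
    proof eventually_elim
      case (elim n)
      moreover have "b (\<epsilon> n) \<ge> 0"
        using b_increasing(1) nonneg by auto
      ultimately show ?case by simp
    qed
    then have "posterior_concentrates \<mu>0 (\<lambda>n. Obs n \<circ> G) \<Gamma> pairing \<nu> a (\<lambda>n. C * b (\<epsilon> n))"
      by (rule transfer)
    moreover have "decseq (\<lambda>n. b (\<epsilon> n))"
      using dec nonneg mono_onD[OF b_increasing(2)] by (simp add: decseq_def)
    ultimately show "posterior_consistent \<mu>0 (\<lambda>n. Obs n \<circ> G) \<Gamma> pairing \<nu> a (\<lambda>n. b (\<epsilon> n))"
      using rate unfolding posterior_consistent_def by blast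
  qed
qed

end
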